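(* Let $A\in\mathbb{R}_{\max}^{p\times n}$, $\mathbf{c}\in\mathbb{R}_{\max}^p$, $B\in\mathbb{G}^{p\times n}$, $\mathbf{d}\in\mathbb{G}^p$ be such that for all $i\in\{1,\dots,p\}$ and $j\in\{1,\dots,n\}$ either $A_{ij}=-\infty$ or $B_{ij}=-\infty$. Let $\mathcal{P}\subset\mathbb{G}^n$ be the set of $\mathbf{x}\in\mathbb{G}^n$ with $A\mathbf{x}\oplus\mathbf{c}\leq_{\mathbb{G}}B\mathbf{x}\oplus\mathbf{d}$. Let $\mathcal{Q}\subset\mathbb{G}^{n-1}$ be the set of $(\mathbf{x}_1,\dots,\mathbf{x}_{n-1})\in\mathbb{G}^{n-1}$ satisfying $$\Big(\bigoplus_{j\neq n}A_{ij}\mathbf{x}_j\Big)\oplus\mathbf{c}_i\leq_{\mathbb{G}}\Big(\bigoplus_{j\neq n}B_{ij}\mathbf{x}_j\Big)\oplus\mathbf{d}_i$$ for all $i$ such that $B_{in}=-\infty$, and $$\Big(\bigoplus_{j\neq n}A_{ij}\mathbf{x}_j\Big)\oplus\mathbf{c}_i\leq_{\mathbb{G}}\Big(\bigoplus_{j\neq n}(B_{ij}\oplus B_{in}A_{kn}^{-1}B_{kj})\mathbf{x}_j\Big)\oplus\mathbf{d}_i\oplus B_{in}A_{kn}^{-1}\mathbf{d}_k$$ for all $i,k$ such that $B_{in}\neq-\infty$ and $A_{kn}\neq-\infty$. Then, for all $\mathbf{x}\in\mathbb{R}_{\max}^{n-1}$, $\mathbf{x}\in\mathcal{Q}$ if,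 and only if, there exists $\lambda\in\mathbb{R}_{\max}$ such that $(\mathbf{x},\lambda)\in\mathcal{P}$.
   Context: $\mathbb{R}_{\max}=\mathbb{R}\cup\{-\infty\}$ is the max-plus semiring ($x\oplus y=\max(x,y)$, $x\otimes y=xy=x+y$), and $\overline{\mathbb{R}}_{\max}=\mathbb{R}_{\max}\cup\{+\infty\}$. Let $\mathbb{R}^-=\{\alpha^-:\alpha\in\mathbb{R}\}$ be a disjoint copy of $\mathbb{R}$ and $\mathbb{G}=\overline{\mathbb{R}}_{\max}\cup\mathbb{R}^-$. The modulus is $|x|=x$ for $x\in\overline{\mathbb{R}}_{\max}$ and $|\alpha^-|=\alpha$. The total order $\leq_{\mathbb{G}}$ is: $x\leq_{\mathbb{G}}y$ iff $|x|<|y|$ when $x\in\overline{\mathbb{R}}_{\max}$ and $y\in\mathbb{R}^-$, and $|x|\le|y|$ in all other cases. $\mathbb{G}$ is a semiring where $x\oplus y$ is the greater of $x,y$ for $\leq_{\mathbb{G}}$, and $xy$ is: $x+y$ if $x,y\in\mathbb{R}$; $(|x|+|y|)^-$ if $x\in\mathbb{R}^-$ or $y\in\mathbb{R}^-$ and both are different from $\pm\infty$; $-\infty$ if $x=-\infty$ or $y=-\infty$; $+\infty$ if neither is $-\infty$ and at least one is $+\infty$. The zero is $-\infty$, the unit is $0$; for $a\in\mathbb{R}$, $a^{-1}=-a$. Matrix-vector operations use $\oplus$ and the product of $\mathbb{G}$; vector inequalities are entrywise. *)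

theory Defs
  imports "HOL-Library.Extended_Real" "Jordan_Normal_Form.Matrix"
begin

section \<open>The semiring of germs\<close>

text \<open>\<open>Ext\<close> embeds the completed max-plus semiring, \<open>Minus \<alpha>\<close> is the copy
  \<open>\<alpha>\<^sup>-\<close> of the real \<open>\<alpha>\<close>, which lies immediately below \<open>Ext \<alpha>\<close>.\<close>

datatype germ = Ext ereal | Minus real

primrec modulus :: "germ \<Rightarrow> ereal" where
  "modulus (Ext x) = x"
| "modulus (Minus \<alpha>) = ereal \<alpha>"

instantiation germ :: linorder
begin

definition less_eq_germ :: "germ \<Rightarrow> germ \<Rightarrow> bool" where
  "less_eq_germ x y \<longleftrightarrow>
    (if x \<in> range Ext \<and> y \<in> range Minus then modulus x < modulus y
     else modulus x \<le> modulus y)"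

lemma less_eq_germ_simps [simp]:
  "Ext x \<le> Ext y \<longleftrightarrow> x \<le> y"
  "Ext x \<le> Minus b \<longleftrightarrow> x < ereal b"
  "Minus a \<le> Ext y \<longleftrightarrow> ereal a \<le> y"
  "Minus a \<le> Minus b \<longleftrightarrow> a \<le> b"
  by (auto simp: less_eq_germ_def image_iff)

definition less_germ :: "germ \<Rightarrow> germ \<Rightarrow> bool" where
  "less_germ x y \<longleftrightarrow> x \<le> y \<and> \<not> y \<le> x"

instance
proof
  fix x y z :: germ
  show "x < y \<longleftrightarrow> x \<le> y \<and> \<not> y \<le> x" by (simp add: less_germ_def)
  show "x \<le> x" by (cases x) auto
  show "x \<le> y \<Longrightarrow> y \<le> z \<Longrightarrow> x \<le> z"
    by (cases x; cases y; cases z)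
       (auto simp flip: ereal_less_eq(3)
             intro: order.trans less_le_trans le_less_trans less_imp_le)
  show "x \<le> y \<Longrightarrow> y \<le> x \<Longrightarrow> x = y"
    by (cases x; cases y) auto
  show "x \<le> y \<or> y \<le> x"
    by (cases x; cases y) auto
qed

end

text \<open>The class operations are the semiring ones: \<open>+\<close> is \<open>\<oplus>\<close>, \<open>*\<close> is the product,
  \<open>0\<close> is \<open>-\<infinity>\<close> and \<open>1\<close> is the real number zero. In particular \<open>\<Sum>\<close> denotes a finite
  \<open>\<Oplus>\<close>, with value \<open>-\<infinity>\<close> on the empty set.\<close>

instantiation germ :: comm_semiring_1
begin

definition zero_germ :: germ where "0 = Ext (-\<infinity>)"

definition one_germ :: germ where "1 = Ext 0"

definition plus_germ :: "germ \<Rightarrow> germ \<Rightarrow> germ" where "plus_germ x y = max x y"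

definition times_germ :: "germ \<Rightarrow> germ \<Rightarrow> germ" where
  "times_germ x y =
    (if x = Ext (-\<infinity>) \<or> y = Ext (-\<infinity>) then Ext (-\<infinity>)
     else if x = Ext \<infinity> \<or> y = Ext \<infinity> then Ext \<infinity>
     else if x \<in> range Minus \<or> y \<in> range Minus
       then Minus (real_of_ereal (modulus x + modulus y))
     else Ext (modulus x + modulus y))"

lemma germ_cases [case_names NegInf Real PosInf Minus]:
  fixes x :: germ
  obtains "x = Ext (-\<infinity>)" | a where "x = Ext (ereal a)" | "x = Ext \<infinity>" | a where "x = Minus a"
proof (cases x)
  case (Ext e)
  then show ?thesis using that by (cases e) auto
qed (use that in auto)

instance
proof
  fix x y z :: germ
  show "x + y + z = x + (y + z)" by (simp add: plus_germ_def max.assoc)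
  show "x + y = y + x" by (simp add: plus_germ_def max.commute)
  show "0 + x = x"
    by (cases x rule: germ_cases) (auto simp: plus_germ_def zero_germ_def max_def)
  show "x * y * z = x * (y * z)"
    by (cases x rule: germ_cases; cases y rule: germ_cases; cases z rule: germ_cases)
       (auto simp: times_germ_def)
  show "x * y = y * x"
    by (cases x rule: germ_cases; cases y rule: germ_cases)
       (auto simp: times_germ_def)
  show "1 * x = x"
    by (cases x rule: germ_cases) (auto simp: times_germ_def one_germ_def zero_ereal_def)
  show "0 * x = 0" "x * 0 = 0"
    by (auto simp: times_germ_def zero_germ_def)
  show "(x + y) * z = x * z + y * z"
    by (cases x rule: germ_cases; cases y rule: germ_cases; cases z rule: germ_cases)
       (auto simp: times_germ_def plus_germ_def max_def)
  show "(0::germ) \<noteq> 1" by (simp add: zero_germ_def one_germ_def)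
qed

end

definition Rmax :: "germ set" where
  "Rmax = {Ext x |x. x \<noteq> \<infinity>}"

text \<open>The inverse of \<open>Ext a\<close> for real \<open>a\<close>; the value \<open>0\<close> elsewhere is a dummy.\<close>

definition germ_inv :: "germ \<Rightarrow> germ" where
  "germ_inv x = (case x of Ext (ereal a) \<Rightarrow> Ext (ereal (- a)) | _ \<Rightarrow> 0)"

section \<open>The polyhedron and its projection\<close>

definition polyP ::
  "nat \<Rightarrow> germ mat \<Rightarrow> germ vec \<Rightarrow> germ mat \<Rightarrow> germ vec \<Rightarrow> germ vec set" where
  "polyP n A c B d = {x \<in> carrier_vec n. A *\<^sub>v x + c \<le> B *\<^sub>v x + d}"

text \<open>Indices start at \<open>0\<close>, so the eliminated last coordinate has index \<open>n - 1\<close>.\<close>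

definition polyQ ::
  "nat \<Rightarrow> nat \<Rightarrow> germ mat \<Rightarrow> germ vec \<Rightarrow> germ mat \<Rightarrow> germ vec \<Rightarrow> germ vec set" where
  "polyQ p n A c B d = {x \<in> carrier_vec (n - 1).
     (\<forall>i<p. B $$ (i, n - 1) = 0 \<longrightarrow>
        (\<Sum>j<n - 1. A $$ (i, j) * x $ j) + c $ i
          \<le> (\<Sum>j<n - 1. B $$ (i, j) * x $ j) + d $ i) \<and>
     (\<forall>i<p. \<forall>k<p. B $$ (i, n - 1) \<noteq> 0 \<and> A $$ (k, n - 1) \<noteq> 0 \<longrightarrow>
        (\<Sum>j<n - 1. A $$ (i, j) * x $ j) + c $ i
          \<le> (\<Sum>j<n - 1.
                (B $$ (i, j) + B $$ (i, n - 1) * germ_inv (A $$ (k, n - 1)) * B $$ (k, j)) * x $ j)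
             + d $ i + B $$ (i, n - 1) * germ_inv (A $$ (k, n - 1)) * d $ k)}"

end

theory Submission
  imports Defs
begin

text \<open>
  In every row with \<open>A\<^sub>k\<^sub>n \<noteq> -\<infinity>\<close> the last coordinate \<open>\<lambda>\<close> is subject to the upper bound
  \<open>\<lambda> \<le> A\<^sub>k\<^sub>n\<inverse> v\<^sub>k\<close>, where \<open>v\<^sub>k\<close> is the rest of the right-hand side. Let \<open>m\<close> be the least of
  these bounds, or \<open>+\<infinity>\<close> if there are none. Membership in \<open>\<Q>\<close> says that every row holds with \<open>m\<close> in
  place of \<open>\<lambda>\<close> on the right-hand side. Since \<open>m\<close> need not lie in \<open>\<real>\<^sub>m\<^sub>a\<^sub>x\<close>, it has to be rounded
  down: because the left-hand sides lie in \<open>\<real>\<^sub>m\<^sub>a\<^sub>x\<close>, an inequality whose right-hand side contains a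
  germ \<open>\<alpha>\<^sup>-\<close> or \<open>+\<infinity>\<close> is strict, and survives the rounding.
\<close>

section \<open>Order and inverses in the semiring of germs\<close>

lemma germ_le_plus [simp]:
  fixes x y :: germ
  shows "x \<le> x + y" "y \<le> x + y"
  by (auto simp: plus_germ_def)

lemma germ_plus_le_iff [simp]: "x + y \<le> z \<longleftrightarrow> x \<le> z \<and> y \<le> (z :: germ)"
  by (auto simp: plus_germ_def)

lemma germ_le_plus_iff: "z \<le> x + y \<longleftrightarrow> z \<le> x \<or> z \<le> (y :: germ)"
  by (auto simp: plus_germ_def le_max_iff_disj)

lemma germ_zero_le [simp]: "0 \<le> (x :: germ)"
  by (cases x) (auto simp: zero_germ_def)

lemma germ_le_infinity [simp]: "x \<le> Ext \<infinity>"
  by (cases x) auto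

lemma germ_mult_left_mono:
  fixes x y z :: germ
  assumes "x \<le> y"
  shows "z * x \<le> z * y"
proof -
  have "y = x + y"
    using assms by (simp add: plus_germ_def max_absorb2)
  then have "z * y = z * x + z * y"
    by (metis distrib_left)
  then show ?thesis
    by (metis germ_le_plus(1))
qed

lemma germ_sum_le: "(\<And>i. i \<in> I \<Longrightarrow> f i \<le> z) \<Longrightarrow> sum f I \<le> (z :: germ)"
  by (induction I rule: infinite_finite_induct) auto

lemma Rmax_cases:
  assumes "x \<in> Rmax"
  obtains "x = 0" | a where "x = Ext (ereal a)"
  using assms by (cases x rule: germ_cases) (auto simp: Rmax_def zero_germ_def)

lemma zero_Rmax [simp]: "0 \<in> Rmax"
  by (simp add: Rmax_def zero_germ_def)

lemma real_Rmax [simp]: "Ext (ereal a) \<in> Rmax"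
  by (simp add: Rmax_def)

lemma plus_Rmax: "x \<in> Rmax \<Longrightarrow> y \<in> Rmax \<Longrightarrow> x + y \<in> Rmax"
  by (auto simp: plus_germ_def max_def)

lemma mult_Rmax: "x \<in> Rmax \<Longrightarrow> y \<in> Rmax \<Longrightarrow> x * y \<in> Rmax"
  by (cases x rule: germ_cases; cases y rule: germ_cases) (auto simp: Rmax_def times_germ_def)

lemma sum_Rmax: "(\<And>i. i \<in> I \<Longrightarrow> f i \<in> Rmax) \<Longrightarrow> sum f I \<in> Rmax"
  by (induction I rule: infinite_finite_induct) (auto intro: plus_Rmax)

lemma germ_inv_mult:
  assumes "a \<in> Rmax" "a \<noteq> 0"
  shows "germ_inv a * a = 1"
  using assms
  by (auto elim!: Rmax_cases simp: germ_inv_def times_germ_def one_germ_def zero_ereal_def)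

text \<open>Multiplication by the unit \<open>a\<close> is monotone and is undone by the monotone
  multiplication by \<open>germ_inv a\<close>. This turns a row into an upper bound on the
  eliminated coordinate.\<close>

lemma germ_le_inv_mult_iff:
  assumes "a \<in> Rmax" "a \<noteq> 0"
  shows "x \<le> germ_inv a * y \<longleftrightarrow> a * x \<le> y"
proof
  assume "x \<le> germ_inv a * y"
  then have "a * x \<le> a * germ_inv a * y"
    by (metis germ_mult_left_mono mult.assoc)
  then show "a * x \<le> y"
    by (simp add: germ_inv_mult[OF assms] mult.commute[of a])
next
  assume "a * x \<le> y"
  then have "germ_inv a * a * x \<le> germ_inv a * y"
    by (metis germ_mult_left_mono mult.assoc)
  then show "x \<le> germ_inv a * y"
    by (simp add: germ_inv_mult[OF assms])
qed

lemma germ_mult_infinity: "b \<noteq> 0 \<Longrightarrow> b * Ext \<infinity> = Ext \<infinity>"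
  by (auto simp: times_germ_def zero_germ_def)

section \<open>Eliminating one variable\<close>

text \<open>The rounding step for a single row. If \<open>m\<close> is in \<open>Rmax\<close> it
  serves itself, and \<open>l = 0\<close> serves when \<open>u\<close> or \<open>b\<close> is
  \<open>0\<close>.\<close>

lemma le_mult_round_down:
  assumes u: "u \<in> Rmax" and le: "u \<le> b * m"
  shows "\<exists>l\<in>Rmax. l \<le> m \<and> u \<le> b * l"
proof (cases "b = 0 \<or> u = 0 \<or> m \<in> Rmax")
  case True
  then consider "m \<in> Rmax" | "u = 0" | "b = 0" by blast
  then show ?thesis
  proof cases
    case 1
    then show ?thesis using le by blast
  next
    case 2
    then show ?thesis by (intro bexI[of _ 0]) auto
  next
    case 3
    then show ?thesis using le by (intro bexI[of _ 0]) auto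
  qed
next
  case False
  then obtain r where r: "u = Ext (ereal r)"
    using u by (auto elim: Rmax_cases)
  \<comment> \<open>If \<open>m = \<alpha>\<^sup>-\<close> and \<open>b\<close> is finite, then \<open>r < \<bar>b\<bar> + \<alpha>\<close>, and any real \<open>l\<close> with \<open>r - \<bar>b\<bar> < l < \<alpha>\<close> will do.\<close>
  define s where "s = real_of_ereal (modulus b)"
  consider \<alpha> where "m = Minus \<alpha>" | "m = Ext \<infinity>"
    using False by (cases m rule: germ_cases) (auto simp: Rmax_def)
  then show ?thesis
  proof cases
    case 1
    have "Ext (ereal ((\<alpha> + (r - s)) / 2)) \<le> m \<and> u \<le> b * Ext (ereal ((\<alpha> + (r - s)) / 2))"
      if "b \<noteq> Ext \<infinity>"
      using that le False 1 r
      by (cases b rule: germ_cases) (auto simp: times_germ_def zero_germ_def s_def field_simps)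
    \<comment> \<open>Here \<open>b * l\<close> is \<infinity> for every real \<open>l\<close>, so
      only \<open>l < \<alpha>\<close> matters.\<close>
    moreover have "Ext (ereal (\<alpha> - 1)) \<le> m \<and> u \<le> b * Ext (ereal (\<alpha> - 1))" if "b = Ext \<infinity>"
      using that 1 r by (auto simp: times_germ_def)
    ultimately show ?thesis by (metis real_Rmax)
  next
    case 2
    \<comment> \<open>For finite \<open>b\<close> the product has modulus \<open>r + 1\<close>, and
      the surplus 1 keeps it above \<open>u\<close> even if \<open>b\<close> is a
      \<open>Minus\<close> germ. For infinite \<open>b\<close> any real works.\<close>
    have "Ext (ereal (r - s + 1)) \<le> m \<and> u \<le> b * Ext (ereal (r - s + 1))"
      using False 2 r
      by (cases b rule: germ_cases) (auto simp: times_germ_def zero_germ_def s_def)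
    then show ?thesis by (metis real_Rmax)
  qed
qed

text \<open>With the other coordinates fixed, \<open>a\<close> and \<open>b\<close> are the last
  columns, and \<open>u\<close> and \<open>v\<close> collect the rest of each row.\<close>

lemma fourier_motzkin_one_variable:
  fixes a b u v :: "nat \<Rightarrow> germ"
  assumes a: "\<And>i. i < p \<Longrightarrow> a i \<in> Rmax" and u: "\<And>i. i < p \<Longrightarrow> u i \<in> Rmax"
    and ab: "\<And>i. i < p \<Longrightarrow> a i = 0 \<or> b i = 0"
  shows "(\<exists>l\<in>Rmax. \<forall>i<p. a i * l + u i \<le> b i * l + v i) \<longleftrightarrow>
    (\<forall>i<p. b i = 0 \<longrightarrow> u i \<le> v i) \<and>
    (\<forall>i<p. \<forall>k<p. b i \<noteq> 0 \<and> a k \<noteq> 0 \<longrightarrow> u i \<le> v i + b i * germ_inv (a k) * v k)"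
    (is "?P \<longleftrightarrow> ?Q")
proof
  assume ?P
  then obtain l where l: "\<forall>i<p. a i * l + u i \<le> b i * l + v i" by blast
  have "u i \<le> v i + b i * germ_inv (a k) * v k"
    if i: "i < p" and k: "k < p" "a k \<noteq> 0" for i k
  proof -
    \<comment> \<open>Since \<open>a k\<close> is nonzero, \<open>b k = 0\<close>, so
      \<open>l\<close> drops out of the right-hand side of row \<open>k\<close>.\<close>
    have "a k * l \<le> v k"
      using l k ab[of k] by auto
    then have "l \<le> germ_inv (a k) * v k"
      using k a by (simp add: germ_le_inv_mult_iff)
    then have "b i * l \<le> b i * germ_inv (a k) * v k"
      by (metis germ_mult_left_mono mult.assoc)
    moreover have "u i \<le> b i * l + v i"
      using l i by auto
    ultimately show ?thesis
      by (auto simp: germ_le_plus_iff)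
  qed
  moreover have "u i \<le> v i" if "i < p" "b i = 0" for i
    using l that by auto
  ultimately show ?Q by blast
next
  assume Q: ?Q
  \<comment> \<open>The top element keeps \<open>M\<close> nonempty without lowering the
    minimum.\<close>
  define M where "M = insert (Ext \<infinity>) ((\<lambda>k. germ_inv (a k) * v k) ` {k. k < p \<and> a k \<noteq> 0})"
  define m where "m = Min M"
  have M: "finite M" "M \<noteq> {}" by (auto simp: M_def)
  have m_in: "m \<in> M" unfolding m_def using M by (rule Min_in)
  have "\<exists>l\<in>Rmax. l \<le> m \<and> u i \<le> v i + b i * l" if i: "i < p" for i
  proof (cases "u i \<le> v i")
    case True
    then show ?thesis by (intro bexI[of _ 0]) auto
  next
    case False
    then have bi: "b i \<noteq> 0" using Q i by blast
    \<comment> \<open>Either \<open>m\<close> is the top element and so is \<open>b i * m\<close>,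
      or \<open>m\<close> is the bound from some row \<open>k\<close>, and the condition for the
      pair \<open>i\<close>, \<open>k\<close> applies.\<close>
    have "u i \<le> b i * m"
      using m_in False Q i bi
      by (auto simp: M_def germ_mult_infinity germ_le_plus_iff mult.assoc)
    then show ?thesis
      using le_mult_round_down[OF u[OF i]] by (auto simp: germ_le_plus_iff)
  qed
  then obtain f where f: "\<And>i. i < p \<Longrightarrow> f i \<in> Rmax \<and> f i \<le> m \<and> u i \<le> v i + b i * f i"
    by metis
  \<comment> \<open>This sum is the maximum of the row-wise choices: it stays below \<open>m\<close>
    and, by monotonicity, serves all rows at once.\<close>
  define l where "l = (\<Sum>i<p. f i)"
  have l_le: "l \<le> m"
    unfolding l_def using f by (auto intro!: germ_sum_le)
  have "a i * l + u i \<le> b i * l + v i" if i: "i < p" for i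
  proof -
    have "f i \<le> l"
      unfolding l_def using i by (subst sum.remove[of _ i]) auto
    then have "b i * f i \<le> b i * l" by (rule germ_mult_left_mono)
    then have "u i \<le> b i * l + v i"
      using f[OF i] by (auto simp: germ_le_plus_iff)
    moreover have "a i * l \<le> v i" if "a i \<noteq> 0"
    proof -
      have "m \<le> germ_inv (a i) * v i"
        unfolding m_def using M i that by (intro Min_le) (auto simp: M_def)
      then show ?thesis
        using l_le a[OF i] that by (simp flip: germ_le_inv_mult_iff)
    qed
    then have "a i * l \<le> b i * l + v i"
      by (cases "a i = 0") (auto simp: germ_le_plus_iff)
    ultimately show ?thesis by simp
  qed
  moreover have "l \<in> Rmax"
    unfolding l_def using f by (intro sum_Rmax) auto
  ultimately show ?P by blast
qed

lemma mult_mat_vec_append_index: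
  fixes M :: "'a :: comm_semiring_0 mat"
  assumes "M \<in> carrier_mat p (Suc q)" "x \<in> carrier_vec q" "i < p"
  shows "(M *\<^sub>v (x @\<^sub>v vec 1 (\<lambda>_. l))) $ i = (\<Sum>j<q. M $$ (i, j) * x $ j) + M $$ (i, q) * l"
  using assms by (simp add: scalar_prod_def atLeast0LessThan)

theorem theorem11:
  fixes A B :: "germ mat" and c d :: "germ vec" and p n :: nat
  assumes "n \<ge> 1"
    and "A \<in> carrier_mat p n" and "elements_mat A \<subseteq> Rmax"
    and "c \<in> carrier_vec p" and "set\<^sub>v c \<subseteq> Rmax"
    and "B \<in> carrier_mat p n"
    and "d \<in> carrier_vec p"
    and "\<And>i j. i < p \<Longrightarrow> j < n \<Longrightarrow> A $$ (i, j) = 0 \<or> B $$ (i, j) = 0"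
  shows "\<forall>x \<in> carrier_vec (n - 1). set\<^sub>v x \<subseteq> Rmax \<longrightarrow>
    (x \<in> polyQ p n A c B d \<longleftrightarrow>
      (\<exists>l \<in> Rmax. x @\<^sub>v vec 1 (\<lambda>_. l) \<in> polyP n A c B d))"
proof (intro ballI impI)
  fix x :: "germ vec"
  assume x: "x \<in> carrier_vec (n - 1)" and xR: "set\<^sub>v x \<subseteq> Rmax"
  obtain q where n: "n = Suc q" using \<open>n \<ge> 1\<close> by (cases n) auto
  have xq: "x \<in> carrier_vec q" using x n by simp
  define u where "u i = (\<Sum>j<q. A $$ (i, j) * x $ j) + c $ i" for i
  define v where "v i = (\<Sum>j<q. B $$ (i, j) * x $ j) + d $ i" for i
  have A: "A $$ (i, j) \<in> Rmax" if "i < p" "j < n" for i j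
    using that by (intro subsetD[OF assms(3)] elements_matI[OF assms(2)]) auto
  have u: "u i \<in> Rmax" if "i < p" for i
  proof -
    have "c $ i \<in> Rmax"
      using assms(4) that by (intro subsetD[OF assms(5)] vec_setI) auto
    moreover have "x $ j \<in> Rmax" if "j < q" for j
      using x n that by (intro subsetD[OF xR] vec_setI) auto
    then have "A $$ (i, j) * x $ j \<in> Rmax" if "j < q" for j
      using A[of i j] \<open>i < p\<close> that n by (intro mult_Rmax) simp_all
    then have "(\<Sum>j<q. A $$ (i, j) * x $ j) \<in> Rmax"
      by (intro sum_Rmax) simp
    ultimately show ?thesis
      unfolding u_def by (intro plus_Rmax)
  qed
  have P: "x @\<^sub>v vec 1 (\<lambda>_. l) \<in> polyP n A c B d \<longleftrightarrow>
      (\<forall>i<p. A $$ (i, q) * l + u i \<le> B $$ (i, q) * l + v i)" for l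
  proof -
    have "x @\<^sub>v vec 1 (\<lambda>_. l) \<in> carrier_vec n"
      using append_carrier_vec[OF xq vec_carrier[of 1 "\<lambda>_. l"]] n by simp
    moreover have "(A *\<^sub>v (x @\<^sub>v vec 1 (\<lambda>_. l)) + c) $ i = A $$ (i, q) * l + u i"
      and "(B *\<^sub>v (x @\<^sub>v vec 1 (\<lambda>_. l)) + d) $ i = B $$ (i, q) * l + v i" if "i < p" for i
      using assms(4,7) that mult_mat_vec_append_index[OF assms(2)[unfolded n] xq that]
        mult_mat_vec_append_index[OF assms(6)[unfolded n] xq that] assms(2,6)
      unfolding u_def v_def by (simp_all add: ac_simps del: index_mult_mat_vec)
    ultimately show ?thesis
      using assms(2,4,6,7) by (simp add: polyP_def less_eq_vec_def del: germ_plus_le_iff index_add_vec(1))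
  qed
  \<comment> \<open>Distributivity gathers all terms coming from row \<open>k\<close> into one
    multiple of \<open>v k\<close>.\<close>
  have "(\<Sum>j<q. (B $$ (i, j) + B $$ (i, q) * germ_inv (A $$ (k, q)) * B $$ (k, j)) * x $ j)
             + d $ i + B $$ (i, q) * germ_inv (A $$ (k, q)) * d $ k
      = v i + B $$ (i, q) * germ_inv (A $$ (k, q)) * v k" for i k
    unfolding v_def by (simp add: algebra_simps sum.distrib sum_distrib_left)
  then have Q: "x \<in> polyQ p n A c B d \<longleftrightarrow>
    (\<forall>i<p. B $$ (i, q) = 0 \<longrightarrow> u i \<le> v i) \<and>
    (\<forall>i<p. \<forall>k<p. B $$ (i, q) \<noteq> 0 \<and> A $$ (k, q) \<noteq> 0 \<longrightarrow>
       u i \<le> v i + B $$ (i, q) * germ_inv (A $$ (k, q)) * v k)"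
    using xq by (simp add: polyQ_def u_def v_def n)
  show "x \<in> polyQ p n A c B d \<longleftrightarrow> (\<exists>l \<in> Rmax. x @\<^sub>v vec 1 (\<lambda>_. l) \<in> polyP n A c B d)"
    unfolding P Q
    by (rule fourier_motzkin_one_variable[symmetric]) (use A u n assms(8) in auto)
qed

end
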